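(* Let $G=(A\cup B,E)$ with $|A|=|B|=n$, where each agent has a strict partial order over her neighbors. Let $M^\star$ be a popular assignment in $G$ and let $\vec\alpha$ be a dual certificate of $M^\star$. Then for every $b\in B$, $|\alpha_b|\ge \ell(b)$, where $\ell(b)$ is the level of $b$ when Algorithm 1 (described in the context) terminates on $G$ (for any choice of the maximum matchings computed by the algorithm).
   Context: For a perfect matching $M$ and $(a,b)\in E$: $\mathsf{wt}_M(a,b)=1$ if $b\succ_a M(a)$, $-1$ if $M(a)\succ_a b$, $0$ otherwise. A dual certificate for a popular assignment $M$ is an optimal solution $\vec\alpha$ of the LP $\min\sum_{u\in A\cup B}y_u$ s.t. $y_a+y_b\ge\mathsf{wt}_M(a,b)$ for all $(a,b)\in E$, with $\alpha_a\in\{0,1,\dots,n-1\}$ for $a\in A$, $\alpha_b\in\{0,-1,\dots,-(n-1)\}$ for $b\in B$, and $\sum_u\alpha_u=0$. For a level function $\ell:B\to\mathbb{N}$ and $a\in A$, $\ell^*(a)=\max_{b\in\mathsf{Nbr}(a)}\ell(b)$; $G_\ell=(A\cup B,E_\ell)$ contains $(a,b)\in E$ iff (i) $\ell(b)=\ell^*(a)$ and no neighbor $b'$ of $a$ with $\ell(b')=\ell^*(a)$ satisfies $b'\succ_a b$; or (ii) $\ell(b)=\ell^*(a)-1$, $b\succ_a b'$ for all neighbors $b'$ of $a$ with $\ell(b')=\ell^*(a)$, and no neighbor $b''$ of $a$ with $\ell(b'')=\ell^*(a)-1$ satisfies $b''\succ_a b$. Algorithm 1: set $\ell\equiv 0$;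 while $\ell(b)<n$ for all $b$: compute a maximum matching $M$ in $G_\ell$; if $M$ is perfect return $M$; else increase $\ell(b)$ by 1 for each $b$ unmatched in $M$. If the loop ends, report no popular assignment. Popularity: $\Delta(M,N)$ is the number of agents preferring $M$ to $N$ minus the number preferring $N$ to $M$ (agent $a$ prefers $M$ if matched in $M$ and either unmatched in $N$ or $M(a)\succ_aN(a)$); a popular assignment is a perfect matching $M$ with $\Delta(M,N)\ge0$ for all perfect matchings $N$. *)

theory Defs
  imports Complex_Main
begin

text \<open>
  Agents have type \<open>'a\<close> and objects have type \<open>'b\<close>; only the agents have preferences.
  \<open>pref a b b'\<close> reads \<open>b \<succ>\<^sub>a b'\<close>, i.e. \<open>a\<close> strictly prefers \<open>b\<close> to \<open>b'\<close>.
  Matchings are sets of edges.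
\<close>

type_synonym ('a, 'b) edges = "('a \<times> 'b) set"
type_synonym ('a, 'b) prefs = "'a \<Rightarrow> 'b \<Rightarrow> 'b \<Rightarrow> bool"

definition Nbr :: "('a, 'b) edges \<Rightarrow> 'a \<Rightarrow> 'b set" where
  "Nbr E a = {b. (a, b) \<in> E}"

definition assignment_instance ::
  "'a set \<Rightarrow> 'b set \<Rightarrow> ('a, 'b) edges \<Rightarrow> ('a, 'b) prefs \<Rightarrow> nat \<Rightarrow> bool" where
  "assignment_instance A B E pref n \<longleftrightarrow>
     finite A \<and> finite B \<and> card A = n \<and> card B = n \<and> E \<subseteq> A \<times> B \<and>
     (\<forall>a\<in>A. irreflp_on (Nbr E a) (pref a) \<and> transp_on (Nbr E a) (pref a))"

definition matching :: "('a, 'b) edges \<Rightarrow> ('a, 'b) edges \<Rightarrow> bool" where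
  "matching E M \<longleftrightarrow> M \<subseteq> E \<and>
     (\<forall>a b b'. (a, b) \<in> M \<longrightarrow> (a, b') \<in> M \<longrightarrow> b = b') \<and>
     (\<forall>a a' b. (a, b) \<in> M \<longrightarrow> (a', b) \<in> M \<longrightarrow> a = a')"

definition maximum_matching :: "('a, 'b) edges \<Rightarrow> ('a, 'b) edges \<Rightarrow> bool" where
  "maximum_matching E M \<longleftrightarrow>
     matching E M \<and> (\<forall>N. matching E N \<longrightarrow> card N \<le> card M)"

definition perfect_matching ::
  "'a set \<Rightarrow> 'b set \<Rightarrow> ('a, 'b) edges \<Rightarrow> ('a, 'b) edges \<Rightarrow> bool" where
  "perfect_matching A B E M \<longleftrightarrow> matching E M \<and> Domain M = A \<and> Range M = B"

definition prefers ::
  "('a, 'b) prefs \<Rightarrow> 'a \<Rightarrow> ('a, 'b) edges \<Rightarrow> ('a, 'b) edges \<Rightarrow> bool" where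
  "prefers pref a M N \<longleftrightarrow>
     (\<exists>b. (a, b) \<in> M \<and> (a \<notin> Domain N \<or> (\<exists>b'. (a, b') \<in> N \<and> pref a b b')))"

definition popularity_margin ::
  "'a set \<Rightarrow> ('a, 'b) prefs \<Rightarrow> ('a, 'b) edges \<Rightarrow> ('a, 'b) edges \<Rightarrow> int" where
  "popularity_margin A pref M N =
     int (card {a \<in> A. prefers pref a M N}) - int (card {a \<in> A. prefers pref a N M})"

definition popular_assignment ::
  "'a set \<Rightarrow> 'b set \<Rightarrow> ('a, 'b) edges \<Rightarrow> ('a, 'b) prefs \<Rightarrow> ('a, 'b) edges \<Rightarrow> bool" where
  "popular_assignment A B E pref M \<longleftrightarrow>
     perfect_matching A B E M \<and>
     (\<forall>N. perfect_matching A B E N \<longrightarrow> popularity_margin A pref M N \<ge> 0)"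

text \<open>\<open>partner M a\<close> is \<open>M(a)\<close>; it is meaningful only if \<open>M\<close> is a matching covering \<open>a\<close>.\<close>

definition partner :: "('a, 'b) edges \<Rightarrow> 'a \<Rightarrow> 'b" where
  "partner M a = (THE b. (a, b) \<in> M)"

definition wt :: "('a, 'b) prefs \<Rightarrow> ('a, 'b) edges \<Rightarrow> 'a \<Rightarrow> 'b \<Rightarrow> real" where
  "wt pref M a b =
     (if pref a b (partner M a) then 1 else if pref a (partner M a) b then - 1 else 0)"

text \<open>
  The vertex set is the disjoint union \<open>A <+> B\<close>, so a dual solution is a single
  real vector with entries \<open>y (Inl a)\<close> and \<open>y (Inr b)\<close>, unrestricted in sign.
\<close>

definition dual_feasible ::
  "('a, 'b) edges \<Rightarrow> ('a, 'b) prefs \<Rightarrow> ('a, 'b) edges \<Rightarrow> ('a + 'b \<Rightarrow> real) \<Rightarrow> bool" where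
  "dual_feasible E pref M y \<longleftrightarrow> (\<forall>(a, b)\<in>E. y (Inl a) + y (Inr b) \<ge> wt pref M a b)"

definition dual_optimal ::
  "'a set \<Rightarrow> 'b set \<Rightarrow> ('a, 'b) edges \<Rightarrow> ('a, 'b) prefs \<Rightarrow> ('a, 'b) edges
    \<Rightarrow> ('a + 'b \<Rightarrow> real) \<Rightarrow> bool" where
  "dual_optimal A B E pref M y \<longleftrightarrow>
     dual_feasible E pref M y \<and>
     (\<forall>z. dual_feasible E pref M z \<longrightarrow> (\<Sum>u\<in>A <+> B. y u) \<le> (\<Sum>u\<in>A <+> B. z u))"

definition dual_certificate ::
  "'a set \<Rightarrow> 'b set \<Rightarrow> ('a, 'b) edges \<Rightarrow> ('a, 'b) prefs \<Rightarrow> nat \<Rightarrow> ('a, 'b) edges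
    \<Rightarrow> ('a + 'b \<Rightarrow> real) \<Rightarrow> bool" where
  "dual_certificate A B E pref n M \<alpha> \<longleftrightarrow>
     dual_optimal A B E pref M \<alpha> \<and>
     (\<forall>a\<in>A. \<exists>k<n. \<alpha> (Inl a) = real k) \<and>
     (\<forall>b\<in>B. \<exists>k<n. \<alpha> (Inr b) = - real k) \<and>
     (\<Sum>u\<in>A <+> B. \<alpha> u) = 0"

text \<open>
  The maximum below is used only for agents \<open>a\<close> with at least one neighbor.
\<close>

definition max_level :: "('a, 'b) edges \<Rightarrow> ('b \<Rightarrow> nat) \<Rightarrow> 'a \<Rightarrow> nat" where
  "max_level E l a = Max (l ` Nbr E a)"

text \<open>
  The edges of \<open>G\<^sub>l\<close>. The condition \<open>l b = max_level E l a - 1\<close> is written additively,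
  because subtraction on the naturals would make it hold at level \<open>0\<close>.
\<close>

definition level_edges ::
  "('a, 'b) edges \<Rightarrow> ('a, 'b) prefs \<Rightarrow> ('b \<Rightarrow> nat) \<Rightarrow> ('a, 'b) edges" where
  "level_edges E pref l = {(a, b) \<in> E.
     (l b = max_level E l a \<and>
        \<not> (\<exists>b'\<in>Nbr E a. l b' = max_level E l a \<and> pref a b' b)) \<or>
     (l b + 1 = max_level E l a \<and>
        (\<forall>b'\<in>Nbr E a. l b' = max_level E l a \<longrightarrow> pref a b b') \<and>
        \<not> (\<exists>b''\<in>Nbr E a. l b'' + 1 = max_level E l a \<and> pref a b'' b))}"

definition raise_unmatched ::
  "'b set \<Rightarrow> ('a, 'b) edges \<Rightarrow> ('b \<Rightarrow> nat) \<Rightarrow> 'b \<Rightarrow> nat" where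
  "raise_unmatched B M l b = (if b \<in> B \<and> b \<notin> Range M then l b + 1 else l b)"

text \<open>
  \<open>level_loop A B E pref n l l' r\<close>: some run of the while loop started with levels \<open>l\<close>
  terminates with levels \<open>l'\<close> and result \<open>r\<close>, where \<open>None\<close> reports that there is no
  popular assignment. The relation is nondeterministic in the choice of the maximum matchings.
\<close>

inductive level_loop ::
  "'a set \<Rightarrow> 'b set \<Rightarrow> ('a, 'b) edges \<Rightarrow> ('a, 'b) prefs \<Rightarrow> nat \<Rightarrow> ('b \<Rightarrow> nat)
    \<Rightarrow> ('b \<Rightarrow> nat) \<Rightarrow> ('a, 'b) edges option \<Rightarrow> bool"
  for A B E pref n where
  fail: "\<not> (\<forall>b\<in>B. l b < n) \<Longrightarrow> level_loop A B E pref n l l None"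
| return: "\<forall>b\<in>B. l b < n \<Longrightarrow> maximum_matching (level_edges E pref l) M \<Longrightarrow>
    perfect_matching A B (level_edges E pref l) M \<Longrightarrow>
    level_loop A B E pref n l l (Some M)"
| iterate: "\<forall>b\<in>B. l b < n \<Longrightarrow> maximum_matching (level_edges E pref l) M \<Longrightarrow>
    \<not> perfect_matching A B (level_edges E pref l) M \<Longrightarrow>
    level_loop A B E pref n (raise_unmatched B M l) l' r \<Longrightarrow>
    level_loop A B E pref n l l' r"

definition popular_assignment_algorithm ::
  "'a set \<Rightarrow> 'b set \<Rightarrow> ('a, 'b) edges \<Rightarrow> ('a, 'b) prefs \<Rightarrow> nat
    \<Rightarrow> ('b \<Rightarrow> nat) \<Rightarrow> ('a, 'b) edges option \<Rightarrow> bool" where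
  "popular_assignment_algorithm A B E pref n l r \<longleftrightarrow>
     level_loop A B E pref n (\<lambda>_. 0) l r"

end

(* Put p(b) = |\<alpha>(b)|. Complementary slackness makes the dual constraints compare p(c) with
   p(M*(a)) for every neighbor c of a. Suppose l \<le> p and let S = {b. l(b) = p(b)}. These comparisons
   show that the M*-edges into S lie in G_l and that every G_l-edge at an agent whose M*-partner is in
   S ends in S. Replacing the edges of a matching of G_l into S by the M*-edges into S therefore
   gives a matching of G_l, larger than before if some object of S was unmatched. So a maximum
   matching covers S, only objects with l(b) < p(b) are raised, and l \<le> p is preserved. *)

theory Submission
  imports Defs
begin

lemma matching_partner:
  assumes "matching E M" "(a, b) \<in> M"
  shows "partner M a = b"
  using assms unfolding partner_def matching_def by (intro the_equality) blast+

lemma matching_inj_on: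
  assumes "matching E M"
  shows "inj_on fst M" "inj_on snd M"
  using assms unfolding matching_def inj_on_def by (metis prod.collapse)+

text \<open>\<open>fst\<close> and \<open>snd\<close> map a perfect matching bijectively onto
  \<open>A\<close> and \<open>B\<close>, so the vertex sum regroups along its edges.\<close>

lemma sum_perfect_matching:
  fixes y :: "'a + 'b \<Rightarrow> real"
  assumes "finite A" "finite B" "perfect_matching A B E M"
  shows "(\<Sum>u\<in>A <+> B. y u) = (\<Sum>(a, b)\<in>M. y (Inl a) + y (Inr b))"
proof -
  have m: "matching E M" and A: "A = fst ` M" and B: "B = snd ` M"
    using assms(3) unfolding perfect_matching_def by (auto simp: Domain_fst Range_snd)
  have "(\<Sum>u\<in>A <+> B. y u) = (\<Sum>a\<in>A. y (Inl a)) + (\<Sum>b\<in>B. y (Inr b))"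
    using assms(1,2) by (simp add: sum.Plus)
  also have "(\<Sum>a\<in>A. y (Inl a)) = (\<Sum>e\<in>M. y (Inl (fst e)))"
    unfolding A using matching_inj_on(1)[OF m] by (simp add: sum.reindex)
  also have "(\<Sum>b\<in>B. y (Inr b)) = (\<Sum>e\<in>M. y (Inr (snd e)))"
    unfolding B using matching_inj_on(2)[OF m] by (simp add: sum.reindex)
  finally show ?thesis by (simp add: sum.distrib case_prod_unfold)
qed

text \<open>Complementary slackness: feasibility makes every edge term of \<open>M\<close>
  nonnegative, and these terms add up to the dual value 0, so each one vanishes.\<close>

lemma dual_tight:
  fixes y :: "'a + 'b \<Rightarrow> real"
  assumes "finite A" "finite B" "perfect_matching A B E M" "finite M"
    and feasible: "dual_feasible E pref M y"
    and "(\<Sum>u\<in>A <+> B. y u) = 0"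
    and "(a, b) \<in> M"
  shows "y (Inl a) = - y (Inr b)"
proof -
  have m: "matching E M" using assms(3) unfolding perfect_matching_def by blast
  have nonneg: "0 \<le> (case e of (a, b) \<Rightarrow> y (Inl a) + y (Inr b))" if e: "e \<in> M" for e
  proof (cases e)
    case (Pair a b)
    then have "wt pref M a b \<le> y (Inl a) + y (Inr b)"
      using e m feasible unfolding matching_def dual_feasible_def by auto
    \<comment> \<open>As \<open>partner M a = b\<close>, both tests in \<open>wt\<close> coincide
      and the value \<open>- 1\<close> cannot occur.\<close>
    moreover have "0 \<le> wt pref M a b"
      using e Pair matching_partner[OF m] unfolding wt_def by auto
    ultimately show ?thesis using Pair by simp
  qed
  have "(\<Sum>(a, b)\<in>M. y (Inl a) + y (Inr b)) = 0"
    using sum_perfect_matching[OF assms(1-3)] assms(6) by metis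
  then have "\<forall>e\<in>M. (case e of (a, b) \<Rightarrow> y (Inl a) + y (Inr b)) = 0"
    using nonneg by (subst (asm) sum_nonneg_eq_0_iff[OF assms(4)])
  then show ?thesis using assms(7) by fastforce
qed

text \<open>The dual constraints of a certificate, written with \<open>p b = \<bar>\<alpha> (Inr b)\<bar>\<close>
  after eliminating the agent variables by \<open>dual_tight\<close>.\<close>

definition dual_levels ::
  "('a, 'b) edges \<Rightarrow> ('a, 'b) prefs \<Rightarrow> ('a, 'b) edges \<Rightarrow> ('b \<Rightarrow> nat) \<Rightarrow> bool" where
  "dual_levels E pref M p \<longleftrightarrow> (\<forall>a b c. (a, b) \<in> M \<longrightarrow> (a, c) \<in> E \<longrightarrow>
     p c \<le> p b + 1 \<and> (\<not> pref a b c \<longrightarrow> p c \<le> p b) \<and> (pref a c b \<longrightarrow> p c < p b))"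

text \<open>Substituting the tight value of the agent variable turns the constraint at
  \<open>(a, c)\<close> into \<open>wt pref M a c \<le> p b - p c\<close>. The three clauses of
  \<open>dual_levels\<close> come from the possible weights -1, 0 and 1.\<close>

lemma dual_certificate_levels:
  assumes inst: "assignment_instance A B E pref n"
    and perfect: "perfect_matching A B E M"
    and cert: "dual_certificate A B E pref n M \<alpha>"
  obtains p where "dual_levels E pref M p" "\<forall>b\<in>B. \<alpha> (Inr b) = - real (p b)"
proof -
  have fin: "finite A" "finite B" and sub: "E \<subseteq> A \<times> B"
    using inst unfolding assignment_instance_def by auto
  have m: "matching E M" using perfect unfolding perfect_matching_def by blast
  then have subM: "M \<subseteq> E" unfolding matching_def by blast
  then have finM: "finite M" using sub fin by (meson finite_SigmaI finite_subset)
  have feasible: "dual_feasible E pref M \<alpha>"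
    using cert unfolding dual_certificate_def dual_optimal_def by blast
  obtain p where p: "\<forall>b\<in>B. \<alpha> (Inr b) = - real (p b)"
    using cert unfolding dual_certificate_def by metis
  have "p c \<le> p b + 1 \<and> (\<not> pref a b c \<longrightarrow> p c \<le> p b) \<and> (pref a c b \<longrightarrow> p c < p b)"
    if ab: "(a, b) \<in> M" and ac: "(a, c) \<in> E" for a b c
  proof -
    have "\<alpha> (Inl a) = - \<alpha> (Inr b)"
      using dual_tight[OF fin perfect finM feasible _ ab] cert
      unfolding dual_certificate_def by blast
    moreover have "b \<in> B" "c \<in> B" using ab ac sub subM by auto
    moreover have "wt pref M a c \<le> \<alpha> (Inl a) + \<alpha> (Inr c)"
      using feasible ac unfolding dual_feasible_def by auto
    ultimately have "wt pref M a c \<le> real (p b) - real (p c)" using p by simp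
    then show ?thesis
      unfolding wt_def matching_partner[OF m ab] by (auto split: if_splits)
  qed
  then have "dual_levels E pref M p" unfolding dual_levels_def by blast
  then show thesis using that p by blast
qed

lemma max_level_ge:
  assumes "finite E" "(a, b) \<in> E"
  shows "l b \<le> max_level E l a"
proof -
  have "finite (Nbr E a)"
    using finite_subset[of "Nbr E a" "snd ` E"] assms(1) unfolding Nbr_def by force
  then show ?thesis using assms(2) unfolding max_level_def Nbr_def by simp
qed

lemma max_level_attained:
  assumes "finite E" "(a, b) \<in> E"
  obtains c where "(a, c) \<in> E" "l c = max_level E l a"
proof -
  have "finite (Nbr E a)"
    using finite_subset[of "Nbr E a" "snd ` E"] assms(1) unfolding Nbr_def by force
  moreover have "Nbr E a \<noteq> {}" using assms(2) unfolding Nbr_def by blast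
  ultimately have "max_level E l a \<in> l ` Nbr E a" unfolding max_level_def by (intro Max_in) auto
  then show thesis using that unfolding Nbr_def by auto
qed

text \<open>A neighbor \<open>c\<close> has \<open>l c \<le> p c \<le> p b + 1 = l b + 1\<close>, so
  \<open>b\<close> is at most one level below the top.\<close>

lemma max_level_near:
  assumes "finite E" "M \<subseteq> E" "dual_levels E pref M p" "\<forall>c\<in>Range E. l c \<le> p c"
    and "(a, b) \<in> M" "l b = p b"
  shows "max_level E l a = l b \<or> max_level E l a = l b + 1"
proof -
  have ab: "(a, b) \<in> E" using assms(2,5) by blast
  obtain c where c: "(a, c) \<in> E" "l c = max_level E l a"
    using max_level_attained[OF assms(1) ab] .
  have "l c \<le> p b + 1"
    using c(1) assms(3,5) bspec[OF assms(4), of c] unfolding dual_levels_def by fastforce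
  then show ?thesis using c(2) assms(6) max_level_ge[OF assms(1) ab, of l] by linarith
qed

text \<open>A neighbor preferred to \<open>b\<close> lies strictly below level \<open>l b\<close>,
  and \<open>b\<close> is preferred to every neighbor above it. This gives the first kind of level
  edge if \<open>b\<close> is at the top level and the second kind if it is one below.\<close>

lemma tight_edge_in_level_edges:
  assumes "finite E" "M \<subseteq> E" "dual_levels E pref M p" "\<forall>c\<in>Range E. l c \<le> p c"
    and "(a, b) \<in> M" "l b = p b"
  shows "(a, b) \<in> level_edges E pref l"
proof -
  have less: "l c < l b" if "(a, c) \<in> E" "pref a c b" for c
    using that assms(3,5,6) bspec[OF assms(4), of c] unfolding dual_levels_def by fastforce
  have pref: "pref a b c" if "(a, c) \<in> E" "l b < l c" for c
    using that assms(3,5,6) bspec[OF assms(4), of c] unfolding dual_levels_def by fastforce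
  have ab: "(a, b) \<in> E" using assms(2,5) by blast
  from max_level_near[OF assms] show ?thesis
    using less pref ab unfolding level_edges_def Nbr_def by fastforce
qed

text \<open>Only \<open>p c \<le> l c\<close> needs proof. In each combination of the levels of
  \<open>b\<close> and \<open>c\<close> relative to the top, the level edge rules out the preference
  that would let \<open>p c\<close> exceed \<open>l c\<close>.\<close>

lemma level_edge_tight:
  assumes "finite E" "M \<subseteq> E" "dual_levels E pref M p" "\<forall>c\<in>Range E. l c \<le> p c"
    and "(a, b) \<in> M" "l b = p b" "(a, c) \<in> level_edges E pref l"
  shows "l c = p c"
proof -
  have ab: "(a, b) \<in> E" using assms(2,5) by blast
  have ac: "(a, c) \<in> E" using assms(7) unfolding level_edges_def by blast
  have p: "p c \<le> l b + 1" "\<not> pref a b c \<Longrightarrow> p c \<le> l b" "pref a c b \<Longrightarrow> p c < l b"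
    using assms(3,5,6) ac unfolding dual_levels_def by auto
  \<comment> \<open>The level-edge condition on \<open>c\<close>, instantiated at the single
    competitor \<open>b\<close>.\<close>
  have c: "l c = max_level E l a \<and> (l b = max_level E l a \<longrightarrow> \<not> pref a b c) \<or>
      l c + 1 = max_level E l a \<and> (l b = max_level E l a \<longrightarrow> pref a c b) \<and>
        (l b + 1 = max_level E l a \<longrightarrow> \<not> pref a b c)"
    using assms(7) ab unfolding level_edges_def Nbr_def by blast
  have "p c \<le> l c"
    using max_level_near[OF assms(1-6)]
  proof
    assume "max_level E l a = l b"
    then show ?thesis using c p(2,3) by auto
  next
    assume "max_level E l a = l b + 1"
    then show ?thesis using c p(1,2) by auto
  qed
  then show ?thesis using bspec[OF assms(4) RangeI[OF ac]] by simp
qed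

text \<open>The exchange argument in abstract form: \<open>E\<close> will be the level graph,
  \<open>E'\<close> the full graph, \<open>M\<close> the popular assignment and \<open>S\<close> the
  set of tight objects.\<close>

lemma maximum_matching_covers:
  assumes "finite E" "maximum_matching E N"
    and "matching E' M" "S \<subseteq> Range M" "finite S"
    and inE: "\<And>a b. (a, b) \<in> M \<Longrightarrow> b \<in> S \<Longrightarrow> (a, b) \<in> E"
    and closed: "\<And>a b c. (a, b) \<in> M \<Longrightarrow> b \<in> S \<Longrightarrow> (a, c) \<in> E \<Longrightarrow> c \<in> S"
  shows "S \<subseteq> Range N"
proof
  fix s assume s: "s \<in> S"
  \<comment> \<open>\<open>P\<close> replaces the removed edges \<open>R\<close> of
    \<open>N\<close>, while \<open>K\<close> is kept.\<close>
  define P where "P = {e \<in> M. snd e \<in> S}"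
  define K where "K = {e \<in> N. snd e \<notin> S}"
  define R where "R = {e \<in> N. snd e \<in> S}"
  have N: "matching E N" "\<And>N'. matching E N' \<Longrightarrow> card N' \<le> card N"
    using assms(2) unfolding maximum_matching_def by auto
  have NE: "N \<subseteq> E" using N(1) unfolding matching_def by blast
  have finN: "finite N" using finite_subset[OF NE assms(1)] .
  have "P \<subseteq> E" using inE unfolding P_def by auto
  then have finP: "finite P" using assms(1) finite_subset by blast
  have "snd ` P = S" using assms(4) unfolding P_def by force
  moreover have "inj_on snd P"
    using matching_inj_on(2)[OF assms(3)] unfolding P_def by (rule inj_on_subset) auto
  ultimately have cardP: "card P = card S" by (metis card_image)
  have K: "b = b'" if "(a, b) \<in> K" "(a, b') \<in> K" for a b b'
    using that N(1) unfolding matching_def K_def by blast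
  have K': "a = a'" if "(a, b) \<in> K" "(a', b) \<in> K" for a a' b
    using that N(1) unfolding matching_def K_def by blast
  have P: "b = b'" if "(a, b) \<in> P" "(a, b') \<in> P" for a b b'
    using that assms(3) unfolding matching_def P_def by blast
  have P': "a = a'" if "(a, b) \<in> P" "(a', b) \<in> P" for a a' b
    using that assms(3) unfolding matching_def P_def by blast
  \<comment> \<open>At an agent of \<open>P\<close>, \<open>closed\<close> forces every
    \<open>N\<close>-edge into \<open>S\<close>, so none is kept in \<open>K\<close>.\<close>
  have KP: False if "(a, x) \<in> K" "(a, x') \<in> P" for a x x'
    using that NE closed unfolding K_def P_def by auto
  have KP': False if "(a, b) \<in> K" "(a', b) \<in> P" for a a' b
    using that unfolding K_def P_def by auto
  have "matching E (K \<union> P)"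
    unfolding matching_def
  proof (intro conjI allI impI)
    show "K \<union> P \<subseteq> E" using NE \<open>P \<subseteq> E\<close> unfolding K_def by auto
  next
    fix a b b' assume "(a, b) \<in> K \<union> P" "(a, b') \<in> K \<union> P"
    then show "b = b'" using K P KP by (elim UnE) blast+
  next
    fix a a' b assume "(a, b) \<in> K \<union> P" "(a', b) \<in> K \<union> P"
    then show "a = a'" using K' P' KP' by (elim UnE) blast+
  qed
  then have "card (K \<union> P) \<le> card N" using N(2) by blast
  moreover have "K \<inter> P = {}" unfolding K_def P_def by auto
  then have "card (K \<union> P) = card K + card P"
    using finN finP unfolding K_def by (intro card_Un_disjoint) auto
  moreover have "K \<union> R = N" "K \<inter> R = {}" unfolding K_def R_def by auto
  then have "card N = card K + card R"
    using finN by (metis card_Un_disjoint finite_Un)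
  ultimately have "card S \<le> card R" using cardP by linarith
  moreover have "card R = card (snd ` R)"
    using matching_inj_on(2)[OF N(1)] unfolding R_def
    by (intro card_image[symmetric]) (rule inj_on_subset, auto)
  moreover have "snd ` R \<subseteq> S" unfolding R_def by auto
  \<comment> \<open>The removed edges end in \<open>S\<close> at distinct objects and number at
    least \<open>card S\<close>, so they reach all of it.\<close>
  ultimately have "snd ` R = S" using assms(5) by (metis card_seteq)
  then show "s \<in> Range N" using s unfolding R_def by force
qed

text \<open>Tight objects are matched and keep their level. Any other object has
  \<open>l b < p b\<close>, which leaves room for an increase by 1.\<close>

lemma raise_unmatched_le:
  assumes "finite B" "finite E" "E \<subseteq> A \<times> B" "perfect_matching A B E M"
    and "dual_levels E pref M p" "\<forall>b\<in>B. l b \<le> p b"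
    and max: "maximum_matching (level_edges E pref l) N"
  shows "\<forall>b\<in>B. raise_unmatched B N l b \<le> p b"
proof -
  define S where "S = {b \<in> B. l b = p b}"
  have M: "matching E M" "M \<subseteq> E" "Range M = B"
    using assms(4) unfolding perfect_matching_def matching_def by auto
  have le: "\<forall>c\<in>Range E. l c \<le> p c" using assms(3,6) by auto
  have "level_edges E pref l \<subseteq> E" unfolding level_edges_def by auto
  then have fin: "finite (level_edges E pref l)" using assms(2) finite_subset by blast
  have "S \<subseteq> Range N"
  proof (rule maximum_matching_covers[OF fin max M(1)])
    show "S \<subseteq> Range M" "finite S" using M(3) assms(1) unfolding S_def by auto
  next
    fix a b assume "(a, b) \<in> M" "b \<in> S"
    then show "(a, b) \<in> level_edges E pref l"
      using tight_edge_in_level_edges[OF assms(2) M(2) assms(5) le] unfolding S_def by blast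
  next
    fix a b c assume "(a, b) \<in> M" "b \<in> S" "(a, c) \<in> level_edges E pref l"
    then show "c \<in> S"
      using level_edge_tight[OF assms(2) M(2) assms(5) le] \<open>level_edges E pref l \<subseteq> E\<close> assms(3)
      unfolding S_def by blast
  qed
  then show ?thesis using assms(6) unfolding S_def raise_unmatched_def by fastforce
qed

text \<open>Both exits return the current levels, so the bound holds whether the run succeeds or
  fails.\<close>

lemma level_loop_le:
  assumes "level_loop A B E pref n l l' r"
    and "finite B" "finite E" "E \<subseteq> A \<times> B" "perfect_matching A B E M"
    and "dual_levels E pref M p" "\<forall>b\<in>B. l b \<le> p b"
  shows "\<forall>b\<in>B. l' b \<le> p b"
  using assms(1,7)
proof (induction rule: level_loop.induct)
  case (iterate l N l' r)
  then show ?case using raise_unmatched_le[OF assms(2-6)] by blast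
qed auto

theorem theorem9:
  fixes A :: "'a set" and B :: "'b set" and E :: "('a, 'b) edges"
    and pref :: "('a, 'b) prefs" and n :: nat
    and Mstar :: "('a, 'b) edges" and \<alpha> :: "'a + 'b \<Rightarrow> real"
    and l :: "'b \<Rightarrow> nat" and r :: "('a, 'b) edges option"
  assumes "assignment_instance A B E pref n"
    and "popular_assignment A B E pref Mstar"
    and "dual_certificate A B E pref n Mstar \<alpha>"
    and "popular_assignment_algorithm A B E pref n l r"
  shows "\<forall>b\<in>B. \<bar>\<alpha> (Inr b)\<bar> \<ge> real (l b)"
proof -
  have perfect: "perfect_matching A B E Mstar"
    using assms(2) unfolding popular_assignment_def by blast
  obtain p where p: "dual_levels E pref Mstar p" "\<forall>b\<in>B. \<alpha> (Inr b) = - real (p b)"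
    using dual_certificate_levels[OF assms(1) perfect assms(3)] .
  have fin: "finite A" "finite B" and sub: "E \<subseteq> A \<times> B"
    using assms(1) unfolding assignment_instance_def by auto
  then have "finite E" by (meson finite_SigmaI finite_subset)
  moreover have "level_loop A B E pref n (\<lambda>_. 0) l r"
    using assms(4) unfolding popular_assignment_algorithm_def .
  \<comment> \<open>The initial levels are 0 and \<open>p\<close> takes natural values, so the
    invariant holds at the start.\<close>
  ultimately have "\<forall>b\<in>B. l b \<le> p b"
    using level_loop_le[OF _ fin(2) _ sub perfect p(1)] by blast
  then show ?thesis using p(2) by simp
qed

end
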